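(* Let $S$ be a subset of a real vector space with $0\in S$ and $-S=S$, and let $g$ and $g_i$ ($1\le i\le j$) be odd functions from $S$ into itself (i.e. $g(-x)=-g(x)$) such that, for every positive integer $n$, the equations $g^n(x)=-x$ and $g_i^n(x)=-x$ have finitely many solutions in $S$. Then: (a) For any fixed odd integer $k>0$, letting $\psi_k(n)=\psi_g(kn)$, we have $\Phi_2(\psi_k,n)\equiv 0\pmod{2n}$ for all positive integers $n$. (b) Letting $(\prod_{i=1}^j\psi_{g_i})(n)=\prod_{i=1}^j\psi_{g_i}(n)$, we have $\Phi_2(\prod_{i=1}^j\psi_{g_i},n)\equiv 0\pmod{2n}$ for all positive integers $n$.
   Context: $g^n$ denotes the $n$-th iterate of $g$. For an odd map $h:S\to S$, $\psi_h(n)$ denotes the number of distinct solutions $x\in S$ of $h^n(x)=-x$. For an integer-valued function $\phi$ on the positive integers: if $n=2^{k_0}p_1^{k_1}\cdots p_r^{k_r}$ with distinct odd primes $p_i$, $k_0\ge 0$, $r\ge1$, $k_i\ge1$, then $\Phi_2(\phi,n)=\phi(n)-\sum_i\phi(n/p_i)+\sum_{i_1<i_2}\phi(n/(p_{i_1}p_{i_2}))-\cdots+(-1)^r\phi(n/(p_1\cdots p_r))$; if $n=2^k$ with $k\ge0$, then $\Phi_2(\phi,n)=\phi(n)-1$. *)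

theory Defs
  imports Complex_Main "HOL-Computational_Algebra.Primes" "HOL-Number_Theory.Cong"
begin

definition odd_self_map :: "'a::real_vector set \<Rightarrow> ('a \<Rightarrow> 'a) \<Rightarrow> bool" where
  "odd_self_map S h \<longleftrightarrow> (\<forall>x\<in>S. h x \<in> S \<and> h (- x) = - h x)"

definition antiper_sols :: "'a::real_vector set \<Rightarrow> ('a \<Rightarrow> 'a) \<Rightarrow> nat \<Rightarrow> 'a set" where
  "antiper_sols S h n = {x \<in> S. (h ^^ n) x = - x}"

definition psi :: "'a::real_vector set \<Rightarrow> ('a \<Rightarrow> 'a) \<Rightarrow> nat \<Rightarrow> int" where
  "psi S h n = int (card (antiper_sols S h n))"

text \<open>
  The alternating sum \<open>\<phi>(n) - \<Sum>\<^sub>i \<phi>(n/p\<^sub>i) + \<Sum> \<phi>(n/(p\<^sub>i p\<^sub>j)) - \<dots>\<close> is indexed by the sets \<open>A\<close> of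
  odd prime divisors of \<open>n\<close>; the empty set gives the term \<open>\<phi>(n)\<close>. Only \<open>n > 0\<close> is meaningful.
\<close>

definition Phi2 :: "(nat \<Rightarrow> int) \<Rightarrow> nat \<Rightarrow> int" where
  "Phi2 \<phi> n =
     (if \<exists>k. n = 2 ^ k then \<phi> n - 1
      else \<Sum>A\<in>Pow {p \<in> prime_factors n. odd p}. (- 1) ^ card A * \<phi> (n div \<Prod>A))"

end

theory Submission
  imports Defs "HOL-Library.FuncSet"
begin

text \<open>
  Apart from \<open>0\<close>, every solution of \<open>h\<^sup>n x = - x\<close> has a least antiperiod \<open>m\<close>; it lies on a cycle of
  length \<open>2m\<close>, and \<open>h\<^sup>l x = - x\<close> holds exactly when \<open>l\<close> is an odd multiple of \<open>m\<close>. By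
  inclusion--exclusion \<open>\<Phi>\<^sub>2\<close> therefore counts the points of least antiperiod exactly \<open>n\<close>, and these
  are partitioned into cycles of length \<open>2n\<close>. Part (a) is this statement for \<open>g\<^sup>k\<close>, part (b) for the
  product map on \<open>S\<^sup>j\<close>; only the involution \<open>x \<mapsto> - x\<close> and its unique fixed point matter.
\<close>

section \<open>Inclusion--exclusion over sets of primes\<close>

text \<open>Expand the product of the factors \<open>1 - of_bool (Q p)\<close> over
  \<open>P\<close>: choosing the second term exactly at the members of \<open>A\<close> yields the
  summand of \<open>A\<close>.\<close>

lemma sum_Pow_alternating_indicator:
  assumes "finite P"
  shows "(\<Sum>A\<in>Pow P. (- 1) ^ card A * of_bool (\<forall>p\<in>A. Q p)) =
    (of_bool (\<forall>p\<in>P. \<not> Q p) :: 'b::comm_ring_1)"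
proof -
  have prod_of_bool: "(\<Prod>p\<in>A. of_bool (R p)) = (of_bool (\<forall>p\<in>A. R p) :: 'b)"
    if "finite A" for A and R :: "_ \<Rightarrow> bool"
    using that by (induction A rule: finite_induct) auto
  have "(\<Sum>A\<in>Pow P. (- 1) ^ card A * of_bool (\<forall>p\<in>A. Q p)) =
      (\<Sum>A\<in>Pow P. (- 1) ^ card A * (\<Prod>p\<in>A. of_bool (Q p)) * (\<Prod>p\<in>P - A. 1 :: 'b))"
    by (intro sum.cong) (use assms in \<open>simp_all add: prod_of_bool finite_subset\<close>)
  also have "\<dots> = (\<Prod>p\<in>P. 1 - of_bool (Q p))"
    by (rule prod_diff_conv_sum[OF assms, symmetric])
  also have "\<dots> = of_bool (\<forall>p\<in>P. \<not> Q p)"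
    using assms by (simp add: prod_of_bool flip: of_bool_not_iff)
  finally show ?thesis .
qed

lemma prod_primes_dvd_iff:
  fixes c :: nat
  assumes "finite A" "\<And>p. p \<in> A \<Longrightarrow> prime p"
  shows "\<Prod>A dvd c \<longleftrightarrow> (\<forall>p\<in>A. p dvd c)"
  using assms
proof (induction A rule: finite_induct)
  case (insert p A)
  have "coprime p (\<Prod>A)"
    using insert by (intro prod_coprime_right) (metis insertCI primes_coprime)
  with insert show ?case
    by (auto intro: divides_mult dvd_trans[OF dvd_triv_left] dvd_trans[OF dvd_triv_right])
qed simp

lemma odd_prime_divisor:
  fixes c :: nat
  assumes "odd c" "c \<noteq> 1"
  obtains p where "prime p" "odd p" "p dvd c"
  using assms by (metis dvd_trans prime_factor_nat)

section \<open>Maps commuting with an involution that has a single fixed point\<close>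

text \<open>\<open>s\<close> stands for negation and \<open>z\<close> for the origin. The carrier is
  a bare set, so that a set of tuples with coordinatewise negation is also an instance.\<close>

locale involutive_system =
  fixes X :: "'b set" and s h :: "'b \<Rightarrow> 'b" and z :: 'b
  assumes h_closed: "x \<in> X \<Longrightarrow> h x \<in> X"
    and s_closed: "x \<in> X \<Longrightarrow> s x \<in> X"
    and s_s: "x \<in> X \<Longrightarrow> s (s x) = x"
    and h_s: "x \<in> X \<Longrightarrow> h (s x) = s (h x)"
    and z_in: "z \<in> X"
    and s_fixed_iff: "x \<in> X \<Longrightarrow> s x = x \<longleftrightarrow> x = z"
begin

definition sols :: "nat \<Rightarrow> 'b set" where
  "sols n = {x \<in> X. (h ^^ n) x = s x}"

text \<open>The points of least antiperiod \<open>n\<close>. The point \<open>z\<close> is removed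
  because it lies on a cycle of length 1 and solves the equation for every \<open>n\<close>.\<close>

definition least_sols :: "nat \<Rightarrow> 'b set" where
  "least_sols n = {x \<in> sols n - {z}. \<forall>l. 0 < l \<and> l < n \<longrightarrow> x \<notin> sols l}"

lemma funpow_closed: "x \<in> X \<Longrightarrow> (h ^^ n) x \<in> X"
  by (induction n) (auto simp: h_closed)

lemma funpow_s: "x \<in> X \<Longrightarrow> (h ^^ n) (s x) = s ((h ^^ n) x)"
  by (induction n) (auto simp: h_s funpow_closed)

lemma h_z: "h z = z"
  using h_closed h_s s_fixed_iff z_in by metis

lemma z_in_sols: "z \<in> sols n"
proof -
  have "(h ^^ n) z = z" by (induction n) (auto simp: h_z)
  then show ?thesis using s_fixed_iff[of z] z_in by (simp add: sols_def)
qed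

lemma s_eq_iff: "x \<in> X \<Longrightarrow> y \<in> X \<Longrightarrow> s x = s y \<longleftrightarrow> x = y"
  using s_s by metis

text \<open>Every block of \<open>m\<close> iterations applies \<open>s\<close> once, and
  \<open>s\<close> is an involution, so only the parity of \<open>c\<close> matters.\<close>

lemma funpow_mult_sols:
  assumes "x \<in> sols m"
  shows "(h ^^ (m * c)) x = (if odd c then s x else x)"
proof (induction c)
  case (Suc c)
  have "(h ^^ (m * Suc c)) x = (h ^^ m) ((h ^^ (m * c)) x)"
    by (simp add: funpow_add)
  with Suc assms show ?case by (auto simp: sols_def funpow_s s_s)
qed simp

text \<open>Divide \<open>l\<close> by \<open>m\<close>. According to the parity of the quotient,
  the remainder \<open>r\<close> is a period or an antiperiod of \<open>x\<close>; minimality of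
  \<open>m\<close> leaves only \<open>r = 0\<close> with odd quotient.\<close>

lemma in_sols_iff_odd_multiple:
  assumes x: "x \<in> least_sols m" and m: "m > 0"
  shows "x \<in> sols l \<longleftrightarrow> (\<exists>c. odd c \<and> l = m * c)"
proof
  from x have xX: "x \<in> X" and xm: "x \<in> sols m" and xz: "x \<noteq> z"
    and least: "\<And>l. 0 < l \<Longrightarrow> l < m \<Longrightarrow> (h ^^ l) x \<noteq> s x"
    by (auto simp: least_sols_def sols_def)
  {
    assume "x \<in> sols l"
    then have xl: "(h ^^ l) x = s x" by (simp add: sols_def)
    define q r where "q = l div m" and "r = l mod m"
    have lqr: "l = r + m * q" and rm: "r < m" using m by (auto simp: q_def r_def)
    have eq: "(h ^^ r) ((h ^^ (m * q)) x) = s x"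
      using xl by (simp add: lqr funpow_add)
    show "\<exists>c. odd c \<and> l = m * c"
    proof (cases "odd q")
      case True
      then have "s ((h ^^ r) x) = s x"
        using eq xX by (simp add: funpow_mult_sols[OF xm] funpow_s)
      then have hr: "(h ^^ r) x = x" using s_eq_iff xX funpow_closed by blast
      have "r = 0"
      proof (rule ccontr)
        assume "r \<noteq> 0"
        \<comment> \<open>A period \<open>r\<close> with \<open>0 < r < m\<close> would make
          \<open>m - r\<close> a smaller antiperiod.\<close>
        have "(h ^^ (m - r)) x = (h ^^ (m - r)) ((h ^^ r) x)" by (simp add: hr)
        also have "\<dots> = (h ^^ m) x" using rm by (simp flip: funpow_add comp_apply[of "h ^^ _"])
        also have "\<dots> = s x" using xm by (simp add: sols_def)
        finally show False using least[of "m - r"] \<open>r \<noteq> 0\<close> rm by simp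
      qed
      with True lqr show ?thesis by auto
    next
      case False
      then have hr: "(h ^^ r) x = s x" using eq by (simp add: funpow_mult_sols[OF xm])
      \<comment> \<open>For \<open>r = 0\<close> the point would be fixed by \<open>s\<close>, hence
        equal to \<open>z\<close>.\<close>
      then have "r \<noteq> 0" using xz s_fixed_iff[OF xX] by (cases r) auto
      with hr least rm show ?thesis by auto
    qed
  }
  {
    assume "\<exists>c. odd c \<and> l = m * c"
    then show "x \<in> sols l" using funpow_mult_sols[OF xm] xX by (auto simp: sols_def)
  }
qed

text \<open>A period \<open>l\<close> added to the antiperiod \<open>m\<close> gives the antiperiod
  \<open>m + l\<close>, an odd multiple of \<open>m\<close>; so \<open>l\<close> is an even
  multiple.\<close>

lemma funpow_fixed_iff:
  assumes x: "x \<in> least_sols m" and m: "m > 0"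
  shows "(h ^^ l) x = x \<longleftrightarrow> 2 * m dvd l"
proof
  from x have xX: "x \<in> X" and xm: "x \<in> sols m"
    by (auto simp: least_sols_def sols_def)
  {
    assume "(h ^^ l) x = x"
    then have "x \<in> sols (m + l)" using xm by (auto simp: sols_def funpow_add)
    then obtain c where c: "odd c" "m + l = m * c"
      using in_sols_iff_odd_multiple[OF x m] by blast
    then obtain b where "c = 2 * b + 1" by (auto elim: oddE)
    with c have "l = 2 * m * b" by (simp add: algebra_simps)
    then show "2 * m dvd l" by simp
  }
  {
    assume "2 * m dvd l"
    then obtain b where "l = 2 * m * b" ..
    then have "l = m * (2 * b)" by simp
    then show "(h ^^ l) x = x" using funpow_mult_sols[OF xm, of "2 * b"] by simp
  }
qed

lemma least_solE:
  assumes "x \<in> sols n" "x \<noteq> z" "n > 0"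
  obtains m where "x \<in> least_sols m" "m > 0"
proof -
  let ?P = "\<lambda>l. 0 < l \<and> x \<in> sols l"
  have "?P (LEAST l. ?P l)" by (rule LeastI[of ?P n]) (use assms in auto)
  moreover have "\<not> ?P l" if "l < (LEAST l. ?P l)" for l
    using not_less_Least[OF that] .
  ultimately show thesis using assms by (intro that[of "LEAST l. ?P l"]) (auto simp: least_sols_def)
qed

section \<open>Partition into cycles of length \<open>2 * n\<close>\<close>

lemma sols_invariant:
  assumes "x \<in> sols l"
  shows "(h ^^ i) x \<in> sols l"
proof -
  have "(h ^^ l) ((h ^^ i) x) = (h ^^ i) ((h ^^ l) x)"
    by (metis add.commute comp_apply funpow_add)
  with assms show ?thesis by (simp add: sols_def funpow_closed funpow_s)
qed

lemma least_sols_return: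
  assumes x: "x \<in> least_sols n" and n: "n > 0"
  obtains k where "(h ^^ k) ((h ^^ i) x) = x"
proof
  \<comment> \<open>\<open>2 * n * i\<close> is a multiple of the period that is at least
    \<open>i\<close>, so the remaining number of steps is a genuine difference.\<close>
  have "i \<le> 2 * n * i" using n by simp
  then have "(h ^^ (2 * n * i - i)) ((h ^^ i) x) = (h ^^ (2 * n * i)) x"
    by (metis comp_apply funpow_add le_add_diff_inverse2)
  also have "\<dots> = x" using funpow_fixed_iff[OF x n] by simp
  finally show "(h ^^ (2 * n * i - i)) ((h ^^ i) x) = x" .
qed

text \<open>Antiperiods pass forward along the orbit, and the orbit returns to \<open>x\<close>;
  hence all its points have the same antiperiods.\<close>

lemma least_sols_invariant:
  assumes x: "x \<in> least_sols n" and n: "n > 0"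
  shows "(h ^^ i) x \<in> least_sols n"
proof -
  obtain k where k: "(h ^^ k) ((h ^^ i) x) = x"
    using least_sols_return[OF x n] .
  have "(h ^^ i) x \<in> sols l \<longleftrightarrow> x \<in> sols l" for l
    using sols_invariant[of x l i] sols_invariant[of "(h ^^ i) x" l k] by (auto simp: k)
  moreover have "(h ^^ k) z = z" by (induction k) (auto simp: h_z)
  then have "(h ^^ i) x \<noteq> z" using k x by (auto simp: least_sols_def)
  ultimately show ?thesis using x by (auto simp: least_sols_def)
qed

lemma card_cycle:
  assumes x: "x \<in> least_sols n" and n: "n > 0"
  shows "card (range (\<lambda>i. (h ^^ i) x)) = 2 * n"
proof -
  have per: "(h ^^ (2 * n)) x = x" using funpow_fixed_iff[OF x n] by simp
  have "(h ^^ i) x \<in> (\<lambda>i. (h ^^ i) x) ` {..<2 * n}" for i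
    by (rule image_eqI[where x = "i mod (2 * n)"]) (use n in \<open>simp_all add: funpow_mod_eq[OF per]\<close>)
  then have "range (\<lambda>i. (h ^^ i) x) = (\<lambda>i. (h ^^ i) x) ` {..<2 * n}"
    by blast
  moreover have "inj_on (\<lambda>i. (h ^^ i) x) {..<2 * n}"
  proof (rule linorder_inj_onI)
    fix i j assume ij: "i < j" "i \<in> {..<2 * n}" "j \<in> {..<2 * n}"
    show "(h ^^ i) x \<noteq> (h ^^ j) x"
    proof
      assume eq: "(h ^^ i) x = (h ^^ j) x"
      \<comment> \<open>\<open>h\<close> need not be injective, so \<open>h ^^ i\<close> is not
        cancelled. Instead, \<open>k\<close> further steps lead back to \<open>x\<close>, which
        makes \<open>k + i\<close> and \<open>k + j\<close> both periods; their difference is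
        positive but below \<open>2 * n\<close>.\<close>
      obtain k where k: "(h ^^ k) ((h ^^ i) x) = x" using least_sols_return[OF x n] .
      have "(h ^^ (k + i)) x = x" using k by (simp only: funpow_add comp_apply)
      moreover have "(h ^^ (k + j)) x = x" using k unfolding eq by (simp only: funpow_add comp_apply)
      ultimately have "2 * n dvd k + i" "2 * n dvd k + j"
        by (simp_all only: funpow_fixed_iff[OF x n])
      then have "2 * n dvd (k + j) - (k + i)" by (intro dvd_diff_nat)
      then have "2 * n dvd j - i" by (simp only: add_diff_cancel_left)
      then have "2 * n \<le> j - i" using ij by (intro dvd_imp_le) simp_all
      with ij show False by simp
    qed
  qed auto
  ultimately show ?thesis by (simp add: card_image)
qed

text \<open>Lying on the forward orbit is an equivalence relation here, since orbits are cycles;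
  each class has \<open>2 * n\<close> elements.\<close>

lemma dvd_card_least_sols:
  assumes n: "n > 0" and fin: "finite (sols n)"
  shows "2 * n dvd card (least_sols n)"
proof -
  define r where "r = {(x, y). x \<in> least_sols n \<and> y \<in> range (\<lambda>i. (h ^^ i) x)}"
  show ?thesis
  proof (rule equiv_imp_dvd_card[where r = r])
    show "finite (least_sols n)"
      using fin by (rule rev_finite_subset) (auto simp: least_sols_def)
    show "equiv (least_sols n) r"
    proof (rule equivI)
      show "r \<subseteq> least_sols n \<times> least_sols n"
        using least_sols_invariant[OF _ n] by (auto simp: r_def)
      show "refl_on (least_sols n) r"
        by (auto simp: r_def refl_on_def image_iff intro: exI[of _ 0])
      show "sym r"
      proof (rule symI)
        fix x y assume "(x, y) \<in> r"
        then obtain i where x: "x \<in> least_sols n" and y: "y = (h ^^ i) x"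
          by (auto simp: r_def)
        obtain k where "(h ^^ k) ((h ^^ i) x) = x" using least_sols_return[OF x n] .
        then have "x = (h ^^ k) y" by (simp add: y)
        then show "(y, x) \<in> r" using least_sols_invariant[OF x n] by (auto simp: r_def y)
      qed
      show "trans r"
      proof (rule transI)
        fix x y w assume "(x, y) \<in> r" "(y, w) \<in> r"
        then obtain i k where x: "x \<in> least_sols n" and "y = (h ^^ i) x" "w = (h ^^ k) y"
          by (auto simp: r_def)
        then have "w = (h ^^ (k + i)) x" by (simp add: funpow_add)
        with x show "(x, w) \<in> r" unfolding r_def by blast
      qed
    qed
    fix C assume "C \<in> least_sols n // r"
    then obtain x where "x \<in> least_sols n" "C = range (\<lambda>i. (h ^^ i) x)"
      by (auto simp: r_def quotient_def)
    then show "2 * n dvd card C" using card_cycle[OF _ n] by simp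
  qed
qed

section \<open>\<open>Phi2\<close> as the number of points of least antiperiod
  \<open>n\<close>\<close>

lemma sols_div_imp_sols:
  assumes "x \<in> sols (n div d)" "odd d" "d dvd n"
  shows "x \<in> sols n"
  using assms funpow_mult_sols[OF assms(1), of d] by (auto simp: sols_def)

text \<open>Membership means that \<open>m * c div d\<close> is an odd multiple of \<open>m\<close>.
  Oddness is automatic once \<open>d\<close> divides \<open>c\<close>, because divisors of the odd
  number \<open>c\<close> are odd.\<close>

lemma in_sols_div_iff:
  assumes x: "x \<in> least_sols m" and m: "m > 0" and c: "odd c" and d: "d dvd m * c" "odd d"
  shows "x \<in> sols (m * c div d) \<longleftrightarrow> d dvd c"
proof
  assume "x \<in> sols (m * c div d)"
  then obtain b where "m * c div d = m * b"
    using in_sols_iff_odd_multiple[OF x m] by blast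
  then have "m * c = m * (b * d)" using d(1) by (metis dvd_div_mult_self mult.assoc)
  then show "d dvd c" using m by simp
next
  assume "d dvd c"
  then obtain b where b: "c = d * b" ..
  then have "m * c div d = m * b" using d(2) by (auto simp: odd_pos)
  then show "x \<in> sols (m * c div d)"
    using in_sols_iff_odd_multiple[OF x m] b c by auto
qed

text \<open>This makes the terms of \<open>Phi2\<close> count intersections, as inclusion--exclusion
  requires. For \<open>n = m * c\<close> with \<open>m\<close> the least antiperiod of
  \<open>x\<close>, both sides say that all primes in \<open>A\<close> divide
  \<open>c\<close>.\<close>

lemma in_sols_div_prod_iff:
  assumes n: "n > 0" and A: "A \<subseteq> {p \<in> prime_factors n. odd p}"
  shows "x \<in> sols (n div \<Prod>A) \<longleftrightarrow> x \<in> sols n \<and> (\<forall>p\<in>A. x \<in> sols (n div p))"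
proof -
  have fin: "finite A" using A by (rule finite_subset) simp
  have dvd: "\<Prod>A dvd n" using A fin by (subst prod_primes_dvd_iff) auto
  have odd: "odd (\<Prod>A)" using A fin by (auto simp: even_prod_iff)
  show ?thesis
  proof (cases "x \<in> sols n \<and> x \<noteq> z")
    case True
    then obtain m where m: "x \<in> least_sols m" "m > 0" using least_solE n by blast
    with True obtain c where c: "odd c" "n = m * c" using in_sols_iff_odd_multiple by blast
    have "x \<in> sols (n div \<Prod>A) \<longleftrightarrow> \<Prod>A dvd c"
      using in_sols_div_iff[OF m c(1)] dvd odd c(2) by simp
    also have "\<dots> \<longleftrightarrow> (\<forall>p\<in>A. p dvd c)" using A fin by (intro prod_primes_dvd_iff) auto
    also have "\<dots> \<longleftrightarrow> (\<forall>p\<in>A. x \<in> sols (n div p))"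
      using in_sols_div_iff[OF m c(1)] A c(2) by (intro ball_cong) auto
    finally show ?thesis using True by simp
  next
    case False
    \<comment> \<open>The point \<open>z\<close> satisfies both sides; a point outside
      \<open>sols n\<close> satisfies neither.\<close>
    show ?thesis using False sols_div_imp_sols[OF _ odd dvd] z_in_sols by auto
  qed
qed

lemma Phi2_eq_card_least_sols:
  assumes n: "n > 0" and fin: "finite (sols n)"
  shows "Phi2 (\<lambda>m. int (card (sols m))) n = int (card (least_sols n))"
proof (cases "\<exists>k. n = 2 ^ k")
  case True
  then obtain k where k: "n = 2 ^ k" ..
  \<comment> \<open>The only odd divisor of a power of two is 1, so \<open>z\<close> alone is lost;
    it accounts for the \<open>- 1\<close> in \<open>Phi2\<close>.\<close>
  have "sols n - {z} \<subseteq> least_sols n"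
  proof
    fix x assume x: "x \<in> sols n - {z}"
    then obtain m where m: "x \<in> least_sols m" "m > 0" using least_solE n by blast
    with x obtain c where c: "odd c" "n = m * c" using in_sols_iff_odd_multiple by blast
    then have "c dvd 2 ^ k" using k by simp
    moreover have "coprime c (2 ^ k)" using c(1) by simp
    ultimately have "c = 1" by (metis coprime_absorb_left nat_dvd_1_iff_1)
    with m c show "x \<in> least_sols n" by simp
  qed
  then have "sols n = insert z (least_sols n)" using z_in_sols by (auto simp: least_sols_def)
  moreover from this have "finite (least_sols n)" using fin by simp
  moreover have "z \<notin> least_sols n" by (simp add: least_sols_def)
  ultimately show ?thesis using True by (simp add: Phi2_def)
next
  case False
  define P where "P = {p \<in> prime_factors n. odd p}"
  have finP: "finite P" by (simp add: P_def)
  \<comment> \<open>An odd prime divisor is what sieves out \<open>z\<close>, which lies in every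
    \<open>sols (n div p)\<close>.\<close>
  have "P \<noteq> {}"
  proof -
    obtain k b where b: "n = 2 ^ k * b" "\<not> 2 dvd b"
      using n by (metis multiplicity_decompose' neq0_conv odd_one)
    with False have "b \<noteq> 1" by auto
    with b obtain p where "prime p" "odd p" "p dvd b" using odd_prime_divisor by blast
    with b n have "p \<in> P" by (simp add: P_def prime_factors_dvd)
    then show ?thesis by blast
  qed
  \<comment> \<open>All cardinalities become sums of indicators over the one set
    \<open>sols n\<close>, so that the two summations can be interchanged.\<close>
  have count: "int (card (sols (n div \<Prod>A))) =
      (\<Sum>x\<in>sols n. of_bool (\<forall>p\<in>A. x \<in> sols (n div p)))" if "A \<in> Pow P" for A
  proof -
    have "sols (n div \<Prod>A) = {x \<in> sols n. \<forall>p\<in>A. x \<in> sols (n div p)}"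
      using in_sols_div_prod_iff[OF n] that by (auto simp: P_def)
    then show ?thesis using fin by (simp add: sum_of_bool_eq Int_def)
  qed
  have "Phi2 (\<lambda>m. int (card (sols m))) n =
      (\<Sum>A\<in>Pow P. (- 1) ^ card A * int (card (sols (n div \<Prod>A))))"
    using False by (simp add: Phi2_def P_def)
  also have "\<dots> = (\<Sum>A\<in>Pow P. \<Sum>x\<in>sols n. (- 1) ^ card A * of_bool (\<forall>p\<in>A. x \<in> sols (n div p)))"
    by (intro sum.cong refl) (simp only: count sum_distrib_left)
  also have "\<dots> = (\<Sum>x\<in>sols n. \<Sum>A\<in>Pow P. (- 1) ^ card A * of_bool (\<forall>p\<in>A. x \<in> sols (n div p)))"
    by (rule sum.swap)
  also have "\<dots> = (\<Sum>x\<in>sols n. of_bool (\<forall>p\<in>P. x \<notin> sols (n div p)))"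
    by (simp only: sum_Pow_alternating_indicator[OF finP])
  also have "\<dots> = int (card {x \<in> sols n. \<forall>p\<in>P. x \<notin> sols (n div p)})"
    using fin by (simp add: sum_of_bool_eq Int_def)
  also have "{x \<in> sols n. \<forall>p\<in>P. x \<notin> sols (n div p)} = least_sols n"
  proof (intro equalityI subsetI)
    fix x assume x: "x \<in> {x \<in> sols n. \<forall>p\<in>P. x \<notin> sols (n div p)}"
    with \<open>P \<noteq> {}\<close> z_in_sols have "x \<noteq> z" by auto
    with x obtain m where m: "x \<in> least_sols m" "m > 0" using least_solE n by blast
    with x obtain c where c: "odd c" "n = m * c" using in_sols_iff_odd_multiple by blast
    \<comment> \<open>A prime factor \<open>p\<close> of the odd number \<open>c\<close> would put
      \<open>x\<close> into \<open>sols (n div p)\<close>.\<close>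
    have "c = 1"
    proof (rule ccontr)
      assume "c \<noteq> 1"
      with c obtain p where p: "prime p" "odd p" "p dvd c" using odd_prime_divisor by blast
      with c n have "p \<in> P" by (auto simp: P_def prime_factors_dvd)
      moreover have "x \<in> sols (n div p)" using in_sols_div_iff[OF m c(1)] p c(2) by simp
      ultimately show False using x by auto
    qed
    with m c show "x \<in> least_sols n" by simp
  next
    fix x assume x: "x \<in> least_sols n"
    have "0 < n div p \<and> n div p < n" if "p \<in> P" for p
      using that n by (auto simp: P_def prime_factors_dvd div_greater_zero_iff dvd_imp_le prime_gt_0_nat
          intro!: div_less_dividend prime_gt_1_nat)
    with x show "x \<in> {x \<in> sols n. \<forall>p\<in>P. x \<notin> sols (n div p)}"
      by (auto simp: least_sols_def)
  qed
  finally show ?thesis .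
qed

theorem Phi2_card_sols_cong:
  assumes "n > 0" "finite (sols n)"
  shows "[Phi2 (\<lambda>m. int (card (sols m))) n = 0] (mod int (2 * n))"
  unfolding Phi2_eq_card_least_sols[OF assms] cong_0_iff
  using dvd_card_least_sols[OF assms] by (simp only: of_nat_dvd_iff)

end

section \<open>Product maps and iterates\<close>

text \<open>The product map acts coordinatewise, so its solution set is the product of the solution
  sets of the \<open>f i\<close>, and cardinalities multiply.\<close>

lemma Phi2_prod_psi_cong:
  fixes S :: "'a::real_vector set" and I :: "'i set"
  assumes zero: "0 \<in> S" and sym: "uminus ` S = S" and I: "finite I"
    and odd: "\<And>i. i \<in> I \<Longrightarrow> odd_self_map S (f i)"
    and fin: "\<And>i. i \<in> I \<Longrightarrow> finite (antiper_sols S (f i) n)"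
    and n: "n > 0"
  shows "[Phi2 (\<lambda>m. \<Prod>i\<in>I. psi S (f i) m) n = 0] (mod int (2 * n))"
proof -
  \<comment> \<open>Tuples are extensional functions, and \<open>s\<close>, \<open>h\<close>,
    \<open>z\<close> are restricted to \<open>I\<close>: the common value \<open>undefined\<close>
    outside \<open>I\<close> turns coordinatewise identities into equalities of functions.\<close>
  define X where "X = (\<Pi>\<^sub>E i\<in>I. S)"
  define s where "s = (\<lambda>x :: 'i \<Rightarrow> 'a. \<lambda>i\<in>I. - x i)"
  define h where "h = (\<lambda>x. \<lambda>i\<in>I. f i (x i))"
  define z where "z = (\<lambda>i\<in>I. 0 :: 'a)"
  have neg: "- x \<in> S" if "x \<in> S" for x using sym that by blast
  have f_closed: "f i x \<in> S" and f_neg: "f i (- x) = - f i x" if "i \<in> I" "x \<in> S" for i x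
    using odd[OF that(1)] that(2) by (auto simp: odd_self_map_def)
  have neg_self: "- v = v \<longleftrightarrow> v = 0" for v :: 'a
  proof
    assume "- v = v"
    then have "2 *\<^sub>R v = 0" by (metis add.left_inverse scaleR_2)
    then show "v = 0" by simp
  qed simp
  interpret involutive_system X s h z
  proof
    fix x assume x: "x \<in> X"
    have arb: "x i = undefined" if "i \<notin> I" for i
      using x that unfolding X_def by (rule PiE_arb)
    show "h x \<in> X" "s x \<in> X" using x by (auto simp: X_def h_def s_def intro!: f_closed neg)
    show "s (s x) = x" by (auto simp: s_def fun_eq_iff arb)
    show "h (s x) = s (h x)" using x by (auto simp: X_def s_def h_def fun_eq_iff intro!: f_neg)
    show "s x = x \<longleftrightarrow> x = z"
      using arb by (auto simp: s_def z_def fun_eq_iff restrict_def neg_self)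
  next
    show "z \<in> X" using zero by (auto simp: X_def z_def)
  qed
  have funpow: "(h ^^ m) x = (\<lambda>i\<in>I. (f i ^^ m) (x i))" if "x \<in> X" for m x
      proof (induction m)
    case 0
    show ?case using that by (simp add: X_def)
  next
    case (Suc m)
    then show ?case by (auto simp: h_def fun_eq_iff)
  qed
  have sols: "sols m = (\<Pi>\<^sub>E i\<in>I. antiper_sols S (f i) m)" for m
  proof (intro equalityI subsetI)
    fix x assume x: "x \<in> sols m"
    then have X: "x \<in> X" and eq: "(\<lambda>i\<in>I. (f i ^^ m) (x i)) = (\<lambda>i\<in>I. - x i)"
      unfolding sols_def by (auto simp: funpow s_def)
    have "(f i ^^ m) (x i) = - x i" if "i \<in> I" for i
      using fun_cong[OF eq, of i] that by simp
    with X show "x \<in> (\<Pi>\<^sub>E i\<in>I. antiper_sols S (f i) m)"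
      by (simp add: X_def antiper_sols_def PiE_iff)
  next
    fix x assume x: "x \<in> (\<Pi>\<^sub>E i\<in>I. antiper_sols S (f i) m)"
    then have "x \<in> X" by (auto simp: X_def antiper_sols_def PiE_iff)
    with x show "x \<in> sols m"
      unfolding sols_def by (auto simp: funpow s_def antiper_sols_def fun_eq_iff PiE_iff)
  qed
  have "finite (sols n)" unfolding sols using I fin by (intro finite_PiE) auto
  then have "[Phi2 (\<lambda>m. int (card (sols m))) n = 0] (mod int (2 * n))"
    using Phi2_card_sols_cong n by blast
  then show ?thesis by (simp add: sols card_PiE[OF I] psi_def)
qed

lemma odd_self_map_funpow:
  assumes "odd_self_map S h"
  shows "odd_self_map S (h ^^ k)"
proof -
  have "(h ^^ k) x \<in> S \<and> (h ^^ k) (- x) = - (h ^^ k) x" if "x \<in> S" for x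
    using that assms by (induction k) (auto simp: odd_self_map_def)
  then show ?thesis by (simp add: odd_self_map_def)
qed

lemma antiper_sols_funpow: "antiper_sols S (h ^^ k) n = antiper_sols S h (k * n)"
  by (simp add: antiper_sols_def funpow_mult)

theorem theorem3:
  fixes S :: "'a::real_vector set"
    and g :: "'a \<Rightarrow> 'a"
    and gs :: "nat \<Rightarrow> 'a \<Rightarrow> 'a"
    and j :: nat
  assumes zero: "0 \<in> S"
    and sym: "uminus ` S = S"
    and g_odd: "odd_self_map S g"
    and gs_odd: "\<And>i. i \<in> {1..j} \<Longrightarrow> odd_self_map S (gs i)"
    and g_fin: "\<And>n. n > 0 \<Longrightarrow> finite (antiper_sols S g n)"
    and gs_fin: "\<And>i n. i \<in> {1..j} \<Longrightarrow> n > 0 \<Longrightarrow> finite (antiper_sols S (gs i) n)"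
  shows "(\<forall>k::nat. odd k \<and> k > 0 \<longrightarrow>
            (\<forall>n>0. [Phi2 (\<lambda>m. psi S g (k * m)) n = 0] (mod int (2 * n)))) \<and>
         (\<forall>n>0. [Phi2 (\<lambda>m. \<Prod>i=1..j. psi S (gs i) m) n = 0] (mod int (2 * n)))"
proof (intro conjI allI impI)
  fix k n :: nat assume k: "odd k \<and> k > 0" and n: "n > 0"
  \<comment> \<open>A product with a single factor, belonging to the iterate \<open>g ^^ k\<close>,
    whose \<open>m\<close>-th antiperiodicity equation is the one of \<open>g\<close> for
    \<open>k * m\<close>.\<close>
  have "[Phi2 (\<lambda>m. \<Prod>i\<in>{()}. psi S (g ^^ k) m) n = 0] (mod int (2 * n))"
    using k n by (intro Phi2_prod_psi_cong[OF zero sym])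
      (auto simp: odd_self_map_funpow[OF g_odd] antiper_sols_funpow g_fin)
  then show "[Phi2 (\<lambda>m. psi S g (k * m)) n = 0] (mod int (2 * n))"
    by (simp add: psi_def antiper_sols_funpow)
next
  fix n :: nat assume "n > 0"
  then show "[Phi2 (\<lambda>m. \<Prod>i=1..j. psi S (gs i) m) n = 0] (mod int (2 * n))"
    using gs_odd gs_fin by (intro Phi2_prod_psi_cong[OF zero sym]) auto
qed

end
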